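(* Let $\beta>0$, let $g$ and $h$ be functions on $(0,\beta]$ which are integrable on $[\delta,\beta]$ for every $0<\delta<\beta$, and let $a,b$ be constants. If the generalized improper integrals $Z\!\!\int_0^\beta g(u)\,du$ and $Z\!\!\int_0^\beta h(u)\,du$ both exist (possibly with different initialization functions), then $Z\!\!\int_0^\beta [a g(u)+b h(u)]\,du$ exists and $$a\; Z\!\!\int_0^\beta g(u)\,du+b\; Z\!\!\int_0^\beta h(u)\,du= Z\!\!\int_0^\beta \left[a g(u)+b h(u)\right]du .$$
   Context: Initialization function: a finite real-valued function $w$ on $\mathbb{R}$ for which there is $\epsilon$ with $0<\epsilon\le 1$ such that $w(v)=0$ for $v<\epsilon$, $w(v)=1$ for $v\ge 1$, and $w'(v)\ge 0$ (i.e. $w$ is nondecreasing; $w'$ need not exist classically everywhere). Generalized improper integral (critical lower limit $0$, noncritical upper limit $\beta$): for an initialization function $w$ (not depending on $\delta$), $$Z\!\!\int_{0}^{\beta} g(u)\,du = \lim_{\delta\to 0^+}\left\{\int_0^\delta g(u)\,w(u/\delta)\,du+\int_\delta^\beta g(u)\,du\right\},$$ where the integrals inside the limit are conventional ones (since $w(u/\delta)=0$ for $u<\epsilon\delta$, the first is effectively over $[\epsilon\delta,\delta]$). The integral is said to exist if the limit exists (as a finite number) for some initialization function $w$, and its value is that limit; the value is the same for all initialization functions for which the limit exists. *)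

theory Defs
  imports "HOL-Analysis.Analysis"
begin

text \<open>
  Conventional integrals are Lebesgue integrals. Functions take values in
  \<^typ>\<open>'a::{real_normed_field, euclidean_space}\<close>, which covers \<^typ>\<open>real\<close> and \<^typ>\<open>complex\<close>.
\<close>

definition init_fun :: "(real \<Rightarrow> real) \<Rightarrow> bool" where
  "init_fun w \<longleftrightarrow> mono w \<and>
     (\<exists>\<epsilon>. 0 < \<epsilon> \<and> \<epsilon> \<le> 1 \<and> (\<forall>v<\<epsilon>. w v = 0) \<and> (\<forall>v\<ge>1. w v = 1))"

definition Z_approx ::
  "(real \<Rightarrow> real) \<Rightarrow> real \<Rightarrow> (real \<Rightarrow> 'a::{real_normed_field, euclidean_space}) \<Rightarrow> real \<Rightarrow> 'a" where
  "Z_approx w \<beta> g \<delta> =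
     (LINT u:{0..\<delta>}|lebesgue. w (u / \<delta>) *\<^sub>R g u) + (LINT u:{\<delta>..\<beta>}|lebesgue. g u)"

text \<open>
  The integrability clause ensures that no default value of a non-existing integral enters
  the limit.
\<close>

definition has_Z_integral ::
  "(real \<Rightarrow> 'a::{real_normed_field, euclidean_space}) \<Rightarrow> 'a \<Rightarrow> real \<Rightarrow> bool" where
  "has_Z_integral g I \<beta> \<longleftrightarrow>
     (\<exists>w. init_fun w \<and>
        (\<forall>\<^sub>F \<delta> in at_right 0.
           set_integrable lebesgue {0..\<delta>} (\<lambda>u. w (u / \<delta>) *\<^sub>R g u) \<and>
           set_integrable lebesgue {\<delta>..\<beta>} g) \<and>
        (Z_approx w \<beta> g \<longlongrightarrow> I) (at_right 0))"

definition Z_integrable ::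
  "(real \<Rightarrow> 'a::{real_normed_field, euclidean_space}) \<Rightarrow> real \<Rightarrow> bool" where
  "Z_integrable g \<beta> \<longleftrightarrow> (\<exists>I. has_Z_integral g I \<beta>)"

text \<open>
  The limit does not depend on the initialization function for which it exists, so the
  description below is proper whenever the integral exists.
\<close>

definition Z_integral ::
  "real \<Rightarrow> (real \<Rightarrow> 'a::{real_normed_field, euclidean_space}) \<Rightarrow> 'a" where
  "Z_integral \<beta> g = (THE I. has_Z_integral g I \<beta>)"

end

(*
  Two initialization functions w1, w2 are, up to countably many points, the distribution
  functions of probability measures M, N carried by a compact subset of (0,1]. If s and t are
  independent with laws M and N, the distribution function of s * t is again an initialization
  function w, and by Fubini the regularised integral for w at \<delta> is the N-average over t of the
  one for w1 at \<delta> * t, and likewise the M-average over s of the one for w2 at \<delta> * s.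
  Hence w yields every limit that w1 or w2 yields: limits are unique and a common initialization
  function can be used for g and h, where linearity is obvious.
*)
theory Submission
  imports Defs "HOL-Probability.Distribution_Functions"
begin

text \<open>Completion leaves the measure of the original sets unchanged, so the same countable
  cover serves. Fubini can then be applied to \<open>lebesgue\<close>, the completion of
  \<open>lborel\<close>, paired with a probability law.\<close>

lemma sigma_finite_completion:
  assumes "sigma_finite_measure M"
  shows "sigma_finite_measure (completion M)"
proof -
  obtain A where A: "countable A" "A \<subseteq> sets M" "\<Union>A = space M" "\<forall>a\<in>A. emeasure M a \<noteq> \<infinity>"
    using sigma_finite_measure.sigma_finite_countable[OF assms] by blast
  show ?thesis
  proof
    show "\<exists>A. countable A \<and> A \<subseteq> sets (completion M) \<and> \<Union>A = space (completion M) \<and>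
            (\<forall>a\<in>A. emeasure (completion M) a \<noteq> \<infinity>)"
      using A by (intro exI[of _ A]) (auto simp: subset_iff)
  qed
qed

subsection \<open>Initialization functions\<close>

lemma init_funE:
  assumes "init_fun w"
  obtains \<epsilon> where "0 < \<epsilon>" "\<epsilon> \<le> 1" "\<And>v. v < \<epsilon> \<Longrightarrow> w v = 0" "\<And>v. v \<ge> 1 \<Longrightarrow> w v = 1"
  using assms unfolding init_fun_def by blast

lemma init_fun_mono: "init_fun w \<Longrightarrow> x \<le> y \<Longrightarrow> w x \<le> w y"
  by (simp add: init_fun_def mono_def)

lemma init_fun_bounds:
  assumes "init_fun w"
  shows "0 \<le> w v" "w v \<le> 1"
proof -
  obtain \<epsilon> where e: "0 < \<epsilon>" "\<And>v. v < \<epsilon> \<Longrightarrow> w v = 0" "\<And>v. v \<ge> 1 \<Longrightarrow> w v = 1"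
    using init_funE[OF assms] by metis
  show "0 \<le> w v"
    using init_fun_mono[OF assms, of "min v 0" v] e(2)[of "min v 0"] e(1) by simp
  show "w v \<le> 1"
    using init_fun_mono[OF assms, of v "max v 1"] e(3)[of "max v 1"] by simp
qed

lemma init_fun_measurable: "init_fun w \<Longrightarrow> w \<in> borel_measurable borel"
  by (simp add: init_fun_def borel_measurable_mono)

lemma init_fun_tendsto_at_bot: "init_fun w \<Longrightarrow> (w \<longlongrightarrow> 0) at_bot"
  by (elim init_funE, rule tendsto_eventually)
     (auto simp: eventually_at_bot_dense)

lemma init_fun_tendsto_at_top: "init_fun w \<Longrightarrow> (w \<longlongrightarrow> 1) at_top"
  by (elim init_funE, rule tendsto_eventually)
     (auto simp: eventually_at_top_linorder)

text \<open>An initialization function is only monotone, while a distribution function is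
  right-continuous. The right-hand limits of \<open>w\<close> repair this; they agree with
  \<open>w\<close> at its continuity points, and a monotone function has only countably many
  others.\<close>

lemma init_fun_right_continuous_version:
  assumes w: "init_fun w"
  obtains w' where "init_fun w'" "\<And>a. continuous (at_right a) w'" "countable {v. w' v \<noteq> w v}"
proof -
  define w' where "w' x = (INF y\<in>{x<..}. w y)" for x
  have bdd: "bdd_below (w ` {x<..})" for x
    by (rule bdd_belowI[of _ 0]) (auto simp: init_fun_bounds[OF w])
  have lower: "w x \<le> w' x" for x
    unfolding w'_def by (rule cINF_greatest) (auto intro: init_fun_mono[OF w])
  have upper: "w' x \<le> w y" if "x < y" for x y
    unfolding w'_def using that by (intro cINF_lower bdd) auto
  have mono: "w' x \<le> w' y" if "x \<le> y" for x y
    using that upper[of x y] lower[of y] by (cases "x = y") auto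
  obtain \<epsilon> where e: "0 < \<epsilon>" "\<epsilon> \<le> 1" "\<And>v. v < \<epsilon> \<Longrightarrow> w v = 0" "\<And>v. v \<ge> 1 \<Longrightarrow> w v = 1"
    using init_funE[OF w] by metis
  have "init_fun w'"
    unfolding init_fun_def
  proof (intro conjI exI[of _ \<epsilon>] allI impI)
    show "mono w'" using mono by (simp add: mono_def)
    show "w' v = 0" if v: "v < \<epsilon>" for v
    proof -
      \<comment> \<open>The infimum runs over points strictly to the right of \<open>v\<close>, and
        \<open>w\<close> may jump at \<epsilon>, so the comparison point must still lie below
        \<epsilon>.\<close>
      obtain y where "v < y" "y < \<epsilon>" using dense[OF v] by blast
      then show ?thesis using upper[of v y] lower[of v] e(3)[of y] e(3)[OF v] by simp
    qed
    show "w' v = 1" if v: "1 \<le> v" for v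
      using upper[of v "v + 1"] lower[of v] e(4)[of v] e(4)[of "v + 1"] v by simp
  qed (use e in auto)
  moreover have "continuous (at_right a) w'" for a
    unfolding continuous_within
  proof (rule order_tendstoI)
    show "\<forall>\<^sub>F x in at_right a. c < w' x" if "c < w' a" for c
      unfolding eventually_at_right_field
      using that mono[of a] by (intro exI[of _ "a + 1"]) (auto intro: less_le_trans)
    show "\<forall>\<^sub>F x in at_right a. w' x < c" if "w' a < c" for c
    proof -
      have "\<exists>y>a. w y < c"
        using that unfolding w'_def by (subst (asm) cINF_less_iff[OF _ bdd]) auto
      then obtain y where "y > a" "w y < c" by blast
      then show ?thesis
        unfolding eventually_at_right_field using upper by (intro exI[of _ y]) (auto intro: le_less_trans)
    qed
  qed
  moreover have "countable {v. w' v \<noteq> w v}"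
  proof (rule countable_subset)
    show "countable {v. \<not> isCont w v}"
      using w mono_ctble_discont[of w] by (simp add: init_fun_def)
    show "{v. w' v \<noteq> w v} \<subseteq> {v. \<not> isCont w v}"
    proof (clarify)
      fix v assume ne: "w' v \<noteq> w v" and cont: "isCont w v"
      have "(w \<longlongrightarrow> w v) (at_right v)"
        using cont unfolding isCont_def by (rule filterlim_mono) (auto simp: at_le)
      moreover have "\<forall>\<^sub>F y in at_right v. w' v \<le> w y"
        using upper by (auto simp: eventually_at_right_field intro!: exI[of _ "v + 1"])
      ultimately have "w' v \<le> w v"
        by (intro tendsto_lowerbound) auto
      with ne lower[of v] show False by simp
    qed
  qed
  ultimately show ?thesis by (rule that)
qed

text \<open>The law is the Lebesgue-Stieltjes measure of \<open>w\<close>.\<close>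

lemma init_fun_cdf:
  assumes "init_fun w" "\<And>a. continuous (at_right a) w"
  obtains N where "real_distribution N" "cdf N = w"
proof
  show "real_distribution (interval_measure w)"
    using assms by (intro real_distribution_interval_measure)
      (auto simp: init_fun_mono init_fun_tendsto_at_bot init_fun_tendsto_at_top)
  show "cdf (interval_measure w) = w"
    using assms by (intro cdf_interval_measure) (auto simp: init_fun_mono init_fun_tendsto_at_bot)
qed

lemma init_fun_cdf_support:
  assumes N: "real_distribution N" and i: "init_fun (cdf N)"
  obtains c where "0 < c" "AE t in N. c < t \<and> t \<le> 1"
proof -
  interpret real_distribution N by fact
  obtain \<epsilon> where e: "0 < \<epsilon>" "\<epsilon> \<le> 1" "\<And>v. v < \<epsilon> \<Longrightarrow> cdf N v = 0" "\<And>v. v \<ge> 1 \<Longrightarrow> cdf N v = 1"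
    using init_funE[OF i] by metis
  \<comment> \<open>There may be an atom at \<epsilon> itself; half of it is a point where the
    distribution function certainly vanishes.\<close>
  have "prob {..\<epsilon>/2} = 0" "prob {..1} = 1"
    using e(1) e(3)[of "\<epsilon>/2"] e(4)[of 1] by (auto simp: cdf_def)
  then have "AE t in N. t \<notin> {..\<epsilon>/2}" "AE t in N. t \<in> {..1}"
    using prob_eq_0[of "{..\<epsilon>/2}"] prob_eq_1[of "{..1}"] by simp_all
  then have "AE t in N. \<epsilon>/2 < t \<and> t \<le> 1"
    by eventually_elim auto
  with e(1) show ?thesis by (intro that[of "\<epsilon>/2"]) auto
qed

subsection \<open>Multiplicative convolution\<close>

text \<open>Distribution function of a product of independent variables with distribution function
  \<open>F\<close> and law \<open>N\<close> (\<open>N\<close> carried by the positive reals).\<close>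

definition mult_conv :: "(real \<Rightarrow> real) \<Rightarrow> real measure \<Rightarrow> real \<Rightarrow> real" where
  "mult_conv F N v = (LINT t|N. F (v / t))"

lemma integrable_init_fun_scale:
  assumes F: "init_fun F" and N: "real_distribution N"
  shows "integrable N (\<lambda>t. F (v / t))"
proof -
  interpret real_distribution N by fact
  note [measurable] = init_fun_measurable[OF F]
  show ?thesis
    by (rule integrable_const_bound[of _ 1]) (auto simp: init_fun_bounds[OF F])
qed

text \<open>The law of a product of factors from [\<epsilon>, 1] and (c, 1] is carried by
  [\<epsilon> c, 1].\<close>

lemma init_fun_mult_conv:
  assumes F: "init_fun F" and N: "real_distribution N" "init_fun (cdf N)"
  shows "init_fun (mult_conv F N)"
proof -
  interpret real_distribution N by fact
  obtain c where c: "0 < c" "AE t in N. c < t \<and> t \<le> 1"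
    using init_fun_cdf_support[OF N] .
  obtain \<epsilon> where e: "0 < \<epsilon>" "\<epsilon> \<le> 1" "\<And>v. v < \<epsilon> \<Longrightarrow> F v = 0" "\<And>v. v \<ge> 1 \<Longrightarrow> F v = 1"
    using init_funE[OF F] by metis
  note int = integrable_init_fun_scale[OF F N(1)]
  note [measurable] = init_fun_measurable[OF F]
  show ?thesis
    unfolding init_fun_def
  \<comment> \<open>Only positivity of \<open>c\<close> is known, so the minimum with 1 secures the
    required upper bound on the witness.\<close>
  proof (intro conjI exI[of _ "min 1 (\<epsilon> * c)"] allI impI)
    show "mono (mult_conv F N)"
    proof (rule monoI)
      fix x y :: real assume "x \<le> y"
      from c(2) have "AE t in N. F (x / t) \<le> F (y / t)"
        by eventually_elim (use c \<open>x \<le> y\<close> in \<open>auto intro!: init_fun_mono[OF F] divide_right_mono\<close>)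
      then show "mult_conv F N x \<le> mult_conv F N y"
        unfolding mult_conv_def by (intro integral_mono_AE int)
    qed
    show "mult_conv F N v = 0" if v: "v < min 1 (\<epsilon> * c)" for v
    proof -
      from c(2) have "AE t in N. F (v / t) = 0"
      proof eventually_elim
        case (elim t)
        have "\<epsilon> * c \<le> \<epsilon> * t" using elim e by auto
        then have "v < \<epsilon> * t" using v by simp
        then show ?case using elim c(1) by (intro e(3)) (simp add: divide_simps)
      qed
      then show ?thesis
        unfolding mult_conv_def by (rule integral_eq_zero_AE)
    qed
    show "mult_conv F N v = 1" if v: "1 \<le> v" for v
    proof -
      from c(2) have "AE t in N. F (v / t) = 1"
        by eventually_elim (use c v in \<open>auto intro!: e(4) simp: divide_simps\<close>)
      then have "mult_conv F N v = (LINT t|N. 1)"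
        unfolding mult_conv_def by (intro integral_cong_AE) auto
      then show ?thesis using prob_space by simp
    qed
  qed (use c e in auto)
qed

text \<open>By Fubini both sides at \<open>v\<close> are the probability of
  \<open>s * t \<le> v\<close> for independent \<open>s\<close> and \<open>t\<close>.\<close>

lemma mult_conv_commute:
  assumes M: "real_distribution M" "init_fun (cdf M)"
    and N: "real_distribution N" "init_fun (cdf N)"
  shows "mult_conv (cdf M) N = mult_conv (cdf N) M"
proof
  fix v
  interpret M: real_distribution M by fact
  interpret N: real_distribution N by fact
  interpret P: pair_prob_space M N ..
  \<comment> \<open>Positivity allows \<open>s * t \<le> v\<close> to be solved for either factor
    without reversing the inequality.\<close>
  have pos: "AE s in M. 0 < s" "AE t in N. 0 < t"
    using init_fun_cdf_support[OF M] init_fun_cdf_support[OF N]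
    by (metis (mono_tags, lifting) AE_mp AE_I2 less_trans)+
  have int: "integrable (M \<Otimes>\<^sub>M N) (\<lambda>(s, t). indicator {p. fst p * snd p \<le> v} (s, t) :: real)"
    by (auto intro!: P.P.integrable_const_bound[of _ 1])
  note [measurable] = init_fun_measurable[OF M(2)] init_fun_measurable[OF N(2)]
  have "mult_conv (cdf M) N v = (LINT t|N. LINT s|M. indicator {p. fst p * snd p \<le> v} (s, t))"
    unfolding mult_conv_def
  proof (rule integral_cong_AE)
    show "AE t in N. cdf M (v / t) = (LINT s|M. indicator {p. fst p * snd p \<le> v} (s, t))"
      using pos(2)
    proof eventually_elim
      case (elim t)
      then have "indicator {p. fst p * snd p \<le> v} (s, t) = (indicator {..v / t} s :: real)" for s
        by (simp add: indicator_def field_simps)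
      then show ?case by (simp add: cdf_def)
    qed
  qed (use P.integrable_snd[OF int] in auto)
  also have "\<dots> = (LINT s|M. LINT t|N. indicator {p. fst p * snd p \<le> v} (s, t))"
    by (rule P.Fubini_integral[OF int])
  also have "\<dots> = mult_conv (cdf N) M v"
    unfolding mult_conv_def
  proof (rule integral_cong_AE)
    show "AE s in M. (LINT t|N. indicator {p. fst p * snd p \<le> v} (s, t)) = cdf N (v / s)"
      using pos(1)
    proof eventually_elim
      case (elim s)
      then have "indicator {p. fst p * snd p \<le> v} (s, t) = (indicator {..v / s} t :: real)" for t
        by (simp add: indicator_def field_simps)
      then show ?case by (simp add: cdf_def)
    qed
  qed (use P.integrable_fst[OF int] in auto)
  finally show "mult_conv (cdf M) N v = mult_conv (cdf N) M v" .
qed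

subsection \<open>Regularised integrals\<close>

definition integrable_off_0 :: "real \<Rightarrow> (real \<Rightarrow> 'a::{real_normed_field, euclidean_space}) \<Rightarrow> bool" where
  "integrable_off_0 \<beta> g \<longleftrightarrow> (\<forall>\<delta>. 0 < \<delta> \<longrightarrow> \<delta> < \<beta> \<longrightarrow> set_integrable lebesgue {\<delta>..\<beta>} g)"

lemma integrable_off_0D:
  "integrable_off_0 \<beta> g \<Longrightarrow> 0 < \<delta> \<Longrightarrow> \<delta> < \<beta> \<Longrightarrow> set_integrable lebesgue {\<delta>..\<beta>} g"
  by (simp add: integrable_off_0_def)

lemma integrable_off_0_linear:
  "integrable_off_0 \<beta> g \<Longrightarrow> integrable_off_0 \<beta> h \<Longrightarrow> integrable_off_0 \<beta> (\<lambda>u. a * g u + b * h u)"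
  unfolding integrable_off_0_def
  by (intro allI impI set_integral_add(1) set_integrable_mult_right) auto

text \<open>The weight is at most 1 and vanishes for \<open>u < \<epsilon> * \<delta>\<close>, so
  \<open>g\<close> on [\<epsilon> \<delta>, \<beta>] dominates; nothing is asked of \<open>g\<close>
  near 0.\<close>

lemma Z_approx_integrable:
  fixes g :: "real \<Rightarrow> 'a::{real_normed_field, euclidean_space}"
  assumes w: "init_fun w"
    and g: "integrable_off_0 \<beta> g"
    and d: "0 < \<delta>" "\<delta> < \<beta>"
  shows "set_integrable lebesgue {0..\<beta>} (\<lambda>u. w (u / \<delta>) *\<^sub>R g u)"
proof -
  obtain \<epsilon> where e: "0 < \<epsilon>" "\<epsilon> \<le> 1" "\<And>v. v < \<epsilon> \<Longrightarrow> w v = 0"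
    using init_funE[OF w] by metis
  have "\<epsilon> * \<delta> \<le> \<delta>"
    using e d by (intro mult_left_le_one_le) auto
  then have ed: "0 < \<epsilon> * \<delta>" "\<epsilon> * \<delta> < \<beta>"
    using e d by (simp, linarith)
  note int = integrable_off_0D[OF g ed, unfolded set_integrable_def]
  have [measurable]: "w \<in> borel_measurable borel" "(\<lambda>u. u) \<in> borel_measurable lebesgue"
    by (auto intro: init_fun_measurable w measurable_completion)
  have "integrable lebesgue (\<lambda>u. w (u / \<delta>) *\<^sub>R (indicator {\<epsilon> * \<delta>..\<beta>} u *\<^sub>R g u))"
  proof (rule Bochner_Integration.integrable_bound[OF int])
    show "(\<lambda>u. w (u / \<delta>) *\<^sub>R (indicator {\<epsilon> * \<delta>..\<beta>} u *\<^sub>R g u)) \<in> borel_measurable lebesgue"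
      using borel_measurable_integrable[OF int] by measurable
    show "AE u in lebesgue. norm (w (u / \<delta>) *\<^sub>R (indicator {\<epsilon> * \<delta>..\<beta>} u *\<^sub>R g u))
        \<le> norm (indicator {\<epsilon> * \<delta>..\<beta>} u *\<^sub>R g u)"
      using init_fun_bounds[OF w] by (intro AE_I2) (subst norm_scaleR, auto intro!: mult_left_le_one_le simp: indicator_def)
  qed
  moreover have "w (u / \<delta>) *\<^sub>R (indicator {\<epsilon> * \<delta>..\<beta>} u *\<^sub>R g u) =
      indicator {0..\<beta>} u *\<^sub>R (w (u / \<delta>) *\<^sub>R g u)" for u
    using e(3)[of "u / \<delta>"] ed d by (force simp: indicator_def pos_divide_less_eq not_less)
  ultimately show ?thesis by (simp only: set_integrable_def)
qed

text \<open>From \<delta> on the weight equals 1, so the two pieces share one integrand and merge.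
  Fubini and linearity are applied to this single integral.\<close>

lemma Z_approx_eq:
  fixes g :: "real \<Rightarrow> 'a::{real_normed_field, euclidean_space}"
  assumes w: "init_fun w"
    and g: "integrable_off_0 \<beta> g"
    and d: "0 < \<delta>" "\<delta> < \<beta>"
  shows "Z_approx w \<beta> g \<delta> = (LINT u:{0..\<beta>}|lebesgue. w (u / \<delta>) *\<^sub>R g u)"
proof -
  note int = Z_approx_integrable[OF assms]
  have w1: "w v = 1" if "v \<ge> 1" for v
    using init_funE[OF w] that by metis
  have "(LINT u:{\<delta>..\<beta>}|lebesgue. w (u / \<delta>) *\<^sub>R g u) = (LINT u:{\<delta>..\<beta>}|lebesgue. g u)"
    using d w1 by (intro set_lebesgue_integral_cong) auto
  moreover have "(LINT u:{0..\<delta>} \<union> {\<delta>..\<beta>}|lebesgue. w (u / \<delta>) *\<^sub>R g u) =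
     (LINT u:{0..\<delta>}|lebesgue. w (u / \<delta>) *\<^sub>R g u) + (LINT u:{\<delta>..\<beta>}|lebesgue. w (u / \<delta>) *\<^sub>R g u)"
  proof (rule set_integral_Un_AE)
    \<comment> \<open>Both intervals contain \<delta>; they are disjoint up to this null
      set.\<close>
    have "AE u in lebesgue. u \<notin> {\<delta>}"
      by (intro AE_not_in null_sets_completionI finite_imp_null_set_lborel) auto
    then show "AE u in lebesgue. \<not> (u \<in> {0..\<delta>} \<and> u \<in> {\<delta>..\<beta>})"
      by eventually_elim auto
  qed (use d in \<open>auto intro: set_integrable_subset[OF int]\<close>)
  moreover have "{0..\<delta>} \<union> {\<delta>..\<beta>} = {0..\<beta>}" using d by auto
  ultimately show ?thesis by (simp add: Z_approx_def)
qed

text \<open>Scaling by \<delta> maps the countable exceptional set to a countable, hence null, set.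
  This permits passing to the right-continuous version.\<close>

lemma Z_approx_cong_countable:
  fixes g :: "real \<Rightarrow> 'a::{real_normed_field, euclidean_space}"
  assumes w: "init_fun w" "init_fun w'" "countable {v. w' v \<noteq> w v}"
    and g: "integrable_off_0 \<beta> g"
    and d: "0 < \<delta>" "\<delta> < \<beta>"
  shows "Z_approx w' \<beta> g \<delta> = Z_approx w \<beta> g \<delta>"
proof -
  let ?S = "(\<lambda>v. v * \<delta>) ` {v. w' v \<noteq> w v}"
  have "AE u in lebesgue. u \<notin> ?S"
    using w(3) by (intro AE_not_in null_sets_completionI countable_imp_null_set_lborel) auto
  then have "AE u in lebesgue. indicator {0..\<beta>} u *\<^sub>R (w' (u / \<delta>) *\<^sub>R g u) =
      indicator {0..\<beta>} u *\<^sub>R (w (u / \<delta>) *\<^sub>R g u)"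
  proof eventually_elim
    case (elim u)
    have "w' (u / \<delta>) = w (u / \<delta>)"
    proof (rule ccontr)
      assume "w' (u / \<delta>) \<noteq> w (u / \<delta>)"
      moreover have "u = u / \<delta> * \<delta>" using d by simp
      ultimately show False using elim by blast
    qed
    then show ?case by simp
  qed
  then show ?thesis
    unfolding Z_approx_eq[OF w(1) g d] Z_approx_eq[OF w(2) g d] set_lebesgue_integral_def
    using Z_approx_integrable[OF w(1) g d] Z_approx_integrable[OF w(2) g d]
    by (intro integral_cong_AE) (auto simp: set_integrable_def)
qed

text \<open>Fubini for the double integral of \<open>F (u / (\<delta> * t)) *\<^sub>R g u\<close>.
  The function \<open>H\<close> is its inner integral, so its integrability comes from Fubini; it is
  identified with the regularised integral at \<open>\<delta> * t\<close> only for \<open>t\<close>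
  in the support of \<open>N\<close>, which avoids any measurability question for the
  latter.\<close>

lemma Z_approx_mult_conv:
  fixes g :: "real \<Rightarrow> 'a::{real_normed_field, euclidean_space}"
  assumes F: "init_fun F" and N: "real_distribution N" "init_fun (cdf N)"
    and g: "integrable_off_0 \<beta> g"
    and d: "0 < \<delta>" "\<delta> < \<beta>"
  obtains H where "integrable N H" "Z_approx (mult_conv F N) \<beta> g \<delta> = (LINT t|N. H t)"
    "AE t in N. H t = Z_approx F \<beta> g (\<delta> * t)"
proof -
  interpret N: real_distribution N by fact
  interpret L: sigma_finite_measure "lebesgue :: real measure"
    by (intro sigma_finite_completion sigma_finite_lborel)
  interpret P: pair_sigma_finite "lebesgue :: real measure" N ..
  let ?w = "mult_conv F N"
  obtain c where c: "0 < c" "AE t in N. c < t \<and> t \<le> 1"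
    using init_fun_cdf_support[OF N] .
  obtain \<epsilon> where e: "0 < \<epsilon>" "\<epsilon> \<le> 1" "\<And>v. v < \<epsilon> \<Longrightarrow> F v = 0"
    using init_funE[OF F] by metis
  note iw = init_fun_mult_conv[OF F N]
  obtain \<epsilon>' where e': "0 < \<epsilon>'" "\<epsilon>' \<le> 1" "\<And>v. v < \<epsilon>' \<Longrightarrow> ?w v = 0"
    using init_funE[OF iw] by metis
  \<comment> \<open>Below \<open>\<eta>\<close> both weights vanish for all relevant \<open>t\<close>, so \<open>g\<close> may be cut off to the
    integrable function \<open>k\<close>, which dominates the integrand of the double integral.\<close>
  define \<eta> where "\<eta> = min (\<delta> / 2) (min (\<epsilon> * c) \<epsilon>' * \<delta>)"
  have \<eta>: "0 < \<eta>" "\<eta> < \<beta>" "\<eta> \<le> \<epsilon> * c * \<delta>" "\<eta> \<le> \<epsilon>' * \<delta>"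
    using e e' c d by (auto simp: \<eta>_def min_mult_distrib_right)
  define k where "k u = indicator {\<eta>..\<beta>} u *\<^sub>R g u" for u
  have k: "integrable lebesgue k"
    using integrable_off_0D[OF g \<eta>(1,2)] by (simp add: set_integrable_def k_def[abs_def])
  define f where "f u t = F (u / (\<delta> * t)) *\<^sub>R k u" for u t
  have [measurable]: "F \<in> borel_measurable borel" "(\<lambda>u. u) \<in> borel_measurable lebesgue"
    "k \<in> borel_measurable lebesgue"
    using k by (auto intro: init_fun_measurable F measurable_completion)
  have [measurable]: "(\<lambda>p. fst p) \<in> borel_measurable (lebesgue \<Otimes>\<^sub>M N)"
    by (rule measurable_compose[OF measurable_fst]) measurable
  have int_f: "integrable (lebesgue \<Otimes>\<^sub>M N) (case_prod f)"
  proof (rule Bochner_Integration.integrable_bound)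
    show "integrable (lebesgue \<Otimes>\<^sub>M N) (\<lambda>p. k (fst p))"
      by (rule P.Fubini_integrable) (use k in \<open>auto simp: N.prob_space\<close>)
    show "case_prod f \<in> borel_measurable (lebesgue \<Otimes>\<^sub>M N)"
      unfolding f_def case_prod_beta by measurable
    show "AE p in lebesgue \<Otimes>\<^sub>M N. norm (case_prod f p) \<le> norm (k (fst p))"
      using init_fun_bounds[OF F] by (intro AE_I2) (auto simp: f_def intro!: mult_left_le_one_le)
  qed
  show ?thesis
  proof (rule that[of "\<lambda>t. LINT u|lebesgue. f u t"])
    show "integrable N (\<lambda>t. LINT u|lebesgue. f u t)"
      using P.integrable_snd[OF int_f] by simp
    have "Z_approx ?w \<beta> g \<delta> = (LINT u|lebesgue. LINT t|N. f u t)"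
      unfolding Z_approx_eq[OF iw g d] set_lebesgue_integral_def
    proof (rule Bochner_Integration.integral_cong)
      fix u
      \<comment> \<open>Since u / (\<delta> t) = (u / \<delta>) / t, averaging the weight over
        \<open>t\<close> produces the convolution at u / \<delta>.\<close>
      have "(LINT t|N. f u t) = ?w (u / \<delta>) *\<^sub>R k u"
        using integrable_init_fun_scale[OF F N(1), of "u / \<delta>"] by (simp add: f_def mult_conv_def)
      also have "\<dots> = indicator {0..\<beta>} u *\<^sub>R (?w (u / \<delta>) *\<^sub>R g u)"
        using e'(3)[of "u / \<delta>"] \<eta> d by (force simp: k_def indicator_def pos_divide_less_eq not_less)
      finally show "indicator {0..\<beta>} u *\<^sub>R (?w (u / \<delta>) *\<^sub>R g u) = (LINT t|N. f u t)" ..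
    qed simp
    then show "Z_approx ?w \<beta> g \<delta> = (LINT t|N. LINT u|lebesgue. f u t)"
      using P.Fubini_integral[OF int_f] by simp
    show "AE t in N. (LINT u|lebesgue. f u t) = Z_approx F \<beta> g (\<delta> * t)"
      using c(2)
    proof eventually_elim
      case (elim t)
      then have "\<delta> * t \<le> \<delta>"
        using d by (intro mult_left_le) auto
      then have t: "0 < \<delta> * t" "\<delta> * t < \<beta>"
        using elim c d by (simp, linarith)
      \<comment> \<open>The bound \<open>c < t\<close> makes the cut-off at \<open>\<eta>\<close>
        uniform in \<open>t\<close>: below it the weight \<open>F (u / (\<delta> * t))\<close> is
        already zero.\<close>
      have "\<epsilon> * c * \<delta> \<le> \<epsilon> * t * \<delta>"
        using elim e d by (auto intro!: mult_right_mono mult_left_mono)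
      then have \<eta>t: "\<eta> \<le> \<epsilon> * (\<delta> * t)" using \<eta>(3) by (simp add: mult_ac)
      show ?case
        unfolding Z_approx_eq[OF F g t] set_lebesgue_integral_def
      proof (rule Bochner_Integration.integral_cong)
        fix u
        have "F (u / (\<delta> * t)) = 0" if "u < \<eta>"
          using that \<eta>t t by (intro e(3)) (simp add: pos_divide_less_eq)
        then show "f u t = indicator {0..\<beta>} u *\<^sub>R (F (u / (\<delta> * t)) *\<^sub>R g u)"
          using \<eta>(1) by (force simp: f_def k_def indicator_def not_less)
      qed simp
    qed
  qed
qed

text \<open>An average of regularised integrals at the points \<delta> t, all in (0, \<delta>], is
  as close to \<open>I\<close> as each of them.\<close>

lemma Z_approx_mult_conv_tendsto:
  fixes g :: "real \<Rightarrow> 'a::{real_normed_field, euclidean_space}"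
  assumes F: "init_fun F" and N: "real_distribution N" "init_fun (cdf N)"
    and \<beta>: "\<beta> > 0"
    and g: "integrable_off_0 \<beta> g"
    and lim: "(Z_approx F \<beta> g \<longlongrightarrow> I) (at_right 0)"
  shows "(Z_approx (mult_conv F N) \<beta> g \<longlongrightarrow> I) (at_right 0)"
proof (rule tendstoI)
  fix e :: real assume e: "0 < e"
  interpret N: real_distribution N by fact
  obtain c where c: "0 < c" "AE t in N. c < t \<and> t \<le> 1"
    using init_fun_cdf_support[OF N] .
  have "\<forall>\<^sub>F x in at_right 0. dist (Z_approx F \<beta> g x) I < e / 2"
    using lim e by (intro tendstoD) auto
  then obtain b where b: "b > 0" "\<And>x. 0 < x \<Longrightarrow> x < b \<Longrightarrow> dist (Z_approx F \<beta> g x) I < e / 2"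
    unfolding eventually_at_right_field by auto
  have "dist (Z_approx (mult_conv F N) \<beta> g \<delta>) I < e" if d: "0 < \<delta>" "\<delta> < min b \<beta>" for \<delta>
  proof -
    obtain H where H: "integrable N H" "Z_approx (mult_conv F N) \<beta> g \<delta> = (LINT t|N. H t)"
      "AE t in N. H t = Z_approx F \<beta> g (\<delta> * t)"
      using Z_approx_mult_conv[OF F N g, of \<delta>] d by auto
    \<comment> \<open>As t \<le> 1, the threshold \<open>b\<close> works for all these
      \<open>t\<close> at once, so no convergence theorem for integrals is required.\<close>
    have bound: "AE t in N. norm (H t - I) \<le> e / 2"
      using H(3) c(2)
    proof eventually_elim
      case (elim t)
      have "\<delta> * t \<le> \<delta>"
        using elim d by (intro mult_left_le) auto
      then have "0 < \<delta> * t" "\<delta> * t < b"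
        using elim c d by (simp, linarith)
      with b(2)[of "\<delta> * t"] elim show ?case by (simp add: dist_norm)
    qed
    \<comment> \<open>\<open>N\<close> has total mass 1, so the constant \<open>I\<close> can be
      moved under the integral.\<close>
    have "Z_approx (mult_conv F N) \<beta> g \<delta> - I = (LINT t|N. H t - I)"
      using H(1,2) N.prob_space by simp
    also have "norm \<dots> \<le> (LINT t|N. norm (H t - I))"
      by (rule integral_norm_bound)
    also have "\<dots> \<le> (LINT t|N. e / 2)"
      using H(1) bound by (intro integral_mono_AE) auto
    also have "\<dots> < e" using e N.prob_space by simp
    finally show ?thesis by (simp add: dist_norm)
  qed
  then show "\<forall>\<^sub>F \<delta> in at_right 0. dist (Z_approx (mult_conv F N) \<beta> g \<delta>) I < e"
    unfolding eventually_at_right_field using b(1) \<beta> by (intro exI[of _ "min b \<beta>"]) auto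
qed

subsection \<open>Change of initialization function\<close>

lemma eventually_at_right_0_less:
  fixes \<beta> :: real
  assumes "0 < \<beta>" "\<And>\<delta>. 0 < \<delta> \<Longrightarrow> \<delta> < \<beta> \<Longrightarrow> P \<delta>"
  shows "\<forall>\<^sub>F \<delta> in at_right 0. P \<delta>"
  using assms unfolding eventually_at_right_field by blast

text \<open>The function \<open>w\<close> is chosen before \<open>g\<close> and \<open>I\<close>.
  Hence it serves one integrand with two limits, which gives uniqueness, as well as two different
  integrands, which gives linearity.\<close>

lemma init_fun_common:
  assumes "init_fun w1" "init_fun w2" "0 < \<beta>"
  obtains w where "init_fun w"
    "\<And>(g :: real \<Rightarrow> 'a::{real_normed_field, euclidean_space}) I.
      integrable_off_0 \<beta> g \<Longrightarrow>
      (Z_approx w1 \<beta> g \<longlongrightarrow> I) (at_right 0) \<or> (Z_approx w2 \<beta> g \<longlongrightarrow> I) (at_right 0) \<Longrightarrow>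
      (Z_approx w \<beta> g \<longlongrightarrow> I) (at_right 0)"
proof -
  obtain v1 where v1: "init_fun v1" "\<And>a. continuous (at_right a) v1" "countable {v. v1 v \<noteq> w1 v}"
    using init_fun_right_continuous_version[OF assms(1)] by blast
  obtain v2 where v2: "init_fun v2" "\<And>a. continuous (at_right a) v2" "countable {v. v2 v \<noteq> w2 v}"
    using init_fun_right_continuous_version[OF assms(2)] by blast
  obtain M where M: "real_distribution M" "cdf M = v1" using init_fun_cdf[OF v1(1,2)] .
  obtain N where N: "real_distribution N" "cdf N = v2" using init_fun_cdf[OF v2(1,2)] .
  \<comment> \<open>The one convolution is an average of rescaled copies of \<open>v1\<close> and
    also of \<open>v2\<close>, so it inherits limits from either.\<close>
  have comm: "mult_conv v1 N = mult_conv v2 M"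
    using mult_conv_commute[OF M(1) _ N(1)] M N v1(1) v2(1) by simp
  show ?thesis
  proof (rule that[of "mult_conv v1 N"])
    show "init_fun (mult_conv v1 N)"
      using init_fun_mult_conv[OF v1(1) N(1)] N(2) v2(1) by simp
    fix g :: "real \<Rightarrow> 'a" and I
    assume g: "integrable_off_0 \<beta> g"
    \<comment> \<open>Changing the weight at countably many points leaves the regularised integrals
      unchanged for 0 < \<delta> < \<beta>, hence also their limit.\<close>
    have *: "(Z_approx w' \<beta> g \<longlongrightarrow> I) (at_right 0)"
      if "(Z_approx w \<beta> g \<longlongrightarrow> I) (at_right 0)" "init_fun w" "init_fun w'" "countable {v. w' v \<noteq> w v}"
      for w w'
      using that(1)
      by (rule Lim_transform_eventually)
         (rule eventually_at_right_0_less[OF assms(3)],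
          rule Z_approx_cong_countable[OF that(2,3,4) g, symmetric])
    assume "(Z_approx w1 \<beta> g \<longlongrightarrow> I) (at_right 0) \<or> (Z_approx w2 \<beta> g \<longlongrightarrow> I) (at_right 0)"
    then show "(Z_approx (mult_conv v1 N) \<beta> g \<longlongrightarrow> I) (at_right 0)"
    proof
      assume "(Z_approx w1 \<beta> g \<longlongrightarrow> I) (at_right 0)"
      from *[OF this assms(1) v1(1,3)] show ?thesis
        using N v2(1) by (intro Z_approx_mult_conv_tendsto[OF v1(1) N(1) _ assms(3) g]) auto
    next
      assume "(Z_approx w2 \<beta> g \<longlongrightarrow> I) (at_right 0)"
      from *[OF this assms(2) v2(1,3)] show ?thesis
        unfolding comm
        using M v1(1) by (intro Z_approx_mult_conv_tendsto[OF v2(1) M(1) _ assms(3) g]) auto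
    qed
  qed
qed

section \<open>Existence and uniqueness of the value\<close>

text \<open>For \<open>g\<close> integrable away from 0 the integrability clause holds for every
  \<delta> < \<beta>, so only the limit has to be shown.\<close>

lemma has_Z_integralI:
  fixes g :: "real \<Rightarrow> 'a::{real_normed_field, euclidean_space}"
  assumes "0 < \<beta>" "init_fun w"
    and g: "integrable_off_0 \<beta> g"
    and "(Z_approx w \<beta> g \<longlongrightarrow> I) (at_right 0)"
  shows "has_Z_integral g I \<beta>"
  unfolding has_Z_integral_def
proof (intro exI[of _ w] conjI assms eventually_at_right_0_less[OF assms(1)] integrable_off_0D[OF g])
  fix \<delta> assume "0 < \<delta>" "\<delta> < \<beta>"
  then show "set_integrable lebesgue {0..\<delta>} (\<lambda>u. w (u / \<delta>) *\<^sub>R g u)"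
    by (intro set_integrable_subset[OF Z_approx_integrable[OF assms(2) g]]) auto
qed

text \<open>A common initialization function turns both values into limits of the same
  function.\<close>

lemma has_Z_integral_unique:
  fixes g :: "real \<Rightarrow> 'a::{real_normed_field, euclidean_space}"
  assumes "0 < \<beta>"
    and g: "integrable_off_0 \<beta> g"
    and "has_Z_integral g I \<beta>" "has_Z_integral g J \<beta>"
  shows "I = J"
proof -
  obtain w1 w2 where w: "init_fun w1" "(Z_approx w1 \<beta> g \<longlongrightarrow> I) (at_right 0)"
    "init_fun w2" "(Z_approx w2 \<beta> g \<longlongrightarrow> J) (at_right 0)"
    using assms(3,4) unfolding has_Z_integral_def by blast
  obtain w where "(Z_approx w \<beta> g \<longlongrightarrow> I) (at_right 0)" "(Z_approx w \<beta> g \<longlongrightarrow> J) (at_right 0)"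
    using init_fun_common[OF w(1,3) assms(1)] g w(2,4) by metis
  then show ?thesis by (rule tendsto_unique[rotated]) simp
qed

lemma Z_integral_eqI:
  fixes g :: "real \<Rightarrow> 'a::{real_normed_field, euclidean_space}"
  assumes "0 < \<beta>"
    and g: "integrable_off_0 \<beta> g"
    and "has_Z_integral g I \<beta>"
  shows "Z_integral \<beta> g = I"
  unfolding Z_integral_def
  using assms(3) by (rule the_equality) (rule has_Z_integral_unique[OF assms(1) g _ assms(3)])

section \<open>Linearity\<close>

lemma Z_approx_linear:
  fixes g h :: "real \<Rightarrow> 'a::{real_normed_field, euclidean_space}"
  assumes w: "init_fun w"
    and g: "integrable_off_0 \<beta> g"
    and h: "integrable_off_0 \<beta> h"
    and d: "0 < \<delta>" "\<delta> < \<beta>"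
  shows "Z_approx w \<beta> (\<lambda>u. a * g u + b * h u) \<delta> = a * Z_approx w \<beta> g \<delta> + b * Z_approx w \<beta> h \<delta>"
proof -
  note gh = integrable_off_0_linear[OF g h]
  have ig: "set_integrable lebesgue {0..\<beta>} (\<lambda>u. a * (w (u / \<delta>) *\<^sub>R g u))"
    and ih: "set_integrable lebesgue {0..\<beta>} (\<lambda>u. b * (w (u / \<delta>) *\<^sub>R h u))"
    by (intro set_integrable_mult_right Z_approx_integrable[OF w _ d] g h)+
  have "Z_approx w \<beta> (\<lambda>u. a * g u + b * h u) \<delta> =
      (LINT u:{0..\<beta>}|lebesgue. a * (w (u / \<delta>) *\<^sub>R g u) + b * (w (u / \<delta>) *\<^sub>R h u))"
    unfolding Z_approx_eq[OF w gh d] by (simp add: scaleR_add_right)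
  also have "\<dots> = a * Z_approx w \<beta> g \<delta> + b * Z_approx w \<beta> h \<delta>"
    unfolding Z_approx_eq[OF w g d] Z_approx_eq[OF w h d]
    by (subst set_integral_add(2)[OF ig ih]) (simp only: set_integral_mult_right)
  finally show ?thesis .
qed

theorem mainTheorem4:
  fixes g h :: "real \<Rightarrow> 'a::{real_normed_field, euclidean_space}"
    and a b :: 'a and \<beta> :: real
  assumes "\<beta> > 0"
    and "\<And>\<delta>. 0 < \<delta> \<Longrightarrow> \<delta> < \<beta> \<Longrightarrow> set_integrable lebesgue {\<delta>..\<beta>} g"
    and "\<And>\<delta>. 0 < \<delta> \<Longrightarrow> \<delta> < \<beta> \<Longrightarrow> set_integrable lebesgue {\<delta>..\<beta>} h"
    and "Z_integrable g \<beta>"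
    and "Z_integrable h \<beta>"
  shows "Z_integrable (\<lambda>u. a * g u + b * h u) \<beta> \<and>
    a * Z_integral \<beta> g + b * Z_integral \<beta> h = Z_integral \<beta> (\<lambda>u. a * g u + b * h u)"
proof -
  have g: "integrable_off_0 \<beta> g" and h: "integrable_off_0 \<beta> h"
    using assms(2,3) by (auto simp: integrable_off_0_def)
  obtain I J where I: "has_Z_integral g I \<beta>" and J: "has_Z_integral h J \<beta>"
    using assms(4,5) unfolding Z_integrable_def by blast
  obtain w1 w2 where w12: "init_fun w1" "(Z_approx w1 \<beta> g \<longlongrightarrow> I) (at_right 0)"
    "init_fun w2" "(Z_approx w2 \<beta> h \<longlongrightarrow> J) (at_right 0)"
    using I J unfolding has_Z_integral_def by blast
  \<comment> \<open>The limits for \<open>g\<close> and \<open>h\<close> were given by possibly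
    different weights; with one weight for both, the limit laws apply.\<close>
  obtain w where w: "init_fun w"
    "(Z_approx w \<beta> g \<longlongrightarrow> I) (at_right 0)" "(Z_approx w \<beta> h \<longlongrightarrow> J) (at_right 0)"
    using init_fun_common[OF w12(1,3) assms(1)] g h w12(2,4) by metis
  note int = integrable_off_0_linear[OF g h]
  have "((\<lambda>\<delta>. a * Z_approx w \<beta> g \<delta> + b * Z_approx w \<beta> h \<delta>) \<longlongrightarrow> a * I + b * J) (at_right 0)"
    by (intro tendsto_intros w)
  then have "(Z_approx w \<beta> (\<lambda>u. a * g u + b * h u) \<longlongrightarrow> a * I + b * J) (at_right 0)"
    by (rule Lim_transform_eventually)
       (rule eventually_at_right_0_less[OF assms(1)],
        rule Z_approx_linear[OF w(1) g h, symmetric])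
  then have "has_Z_integral (\<lambda>u. a * g u + b * h u) (a * I + b * J) \<beta>"
    by (rule has_Z_integralI[OF assms(1) w(1) int])
  then show ?thesis
    using Z_integral_eqI[OF assms(1) g I] Z_integral_eqI[OF assms(1) h J] Z_integral_eqI[OF assms(1) int]
    by (auto simp: Z_integrable_def)
qed

end
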